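(* Let $n\ge 3$ and $r\ge 0$ be integers, let $I_n=I(L_n^c)\subseteq R_n$ be the edge ideal of the complement $L_n^c$ of the line graph on $[n]$, and let $I_{n+r}:=\mathrm{Inc}(\mathbb{N})_{n,n+r}(I_n)\subseteq R_{n+r}$. Then \[ I_{n+r} = \big(\, x_ax_b \ :\ 1\le a<b\le n+r,\ \ b-a\ge 2 \,\big). \] Equivalently, the graph associated to $I_{n+r}$ is exactly $L_{n+r}^c$, the complement of the line graph on $[n+r]$; that is, $I_{n+r}=I(L_{n+r}^c)$.
   Context: Let $k$ be a field, $R_m=k[x_1,\dots,x_m]$ and $[m]=\{1,\dots,m\}$. For $n\le m$, $\mathrm{Inc}(\mathbb{N})_{n,m}$ is the set of strictly increasing functions $\pi:[n]\to[m]$; each such $\pi$ induces the $k$-algebra homomorphism $\pi:R_n\to R_m$, $x_i\mapsto x_{\pi(i)}$. For an ideal $I\subseteq R_n$, $\mathrm{Inc}(\mathbb{N})_{n,m}(I):=\sum_{\pi\in\mathrm{Inc}(\mathbb{N})_{n,m}}\pi(I)R_m$, the ideal of $R_m$ generated by the images of $I$ under all such $\pi$. The edge ideal of a simple graph $G$ on $[n]$ is $I(G)=(x_ix_j : \{i,j\}\in E(G))\subseteq R_n$. For each $m$, the graph $L_m^c$ on $[m]$ is the complement of the path with edges $\{i,i+1\}$, $1\le i\le m-1$; i.e. for $i<j$, $\{i,j\}$ is an edge of $L_m^c$ exactly when $j>i+1$. The graph associated to an ideal of $R_m$ generated by squarefree quadratic monomials is the graph on $[m]$ whose edge ideal it is.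 *)

theory Defs
  imports "HOL-Library.Poly_Mapping" "HOL-Library.FuncSet" "HOL-Algebra.Ideal"
begin

text \<open>
  Polynomials over \<open>'k\<close> in the variables \<open>x\<^sub>i\<close> with \<open>i\<close> ranging over all of \<open>nat\<close>: finitely supported
  maps from exponent vectors to coefficients, with the convolution product of
  \<open>Poly_Mapping\<close>. The rings \<open>R\<^sub>m\<close> are carved out as carriers, so that \<open>m\<close> can vary inside a formula
  and \<open>R\<^sub>m\<close> is a subset of \<open>R\<^sub>m\<^sub>'\<close> for \<open>m \<le> m'\<close>.
\<close>

type_synonym 'k mpoly = "(nat \<Rightarrow>\<^sub>0 nat) \<Rightarrow>\<^sub>0 'k"

definition xvar :: "nat \<Rightarrow> 'k::field mpoly" where
  "xvar i = Poly_Mapping.single (Poly_Mapping.single i 1) 1"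

definition const :: "'k::field \<Rightarrow> 'k mpoly" where
  "const c = Poly_Mapping.single 0 c"

definition polys :: "nat \<Rightarrow> 'k::field mpoly set" where
  "polys m = {p. \<forall>\<alpha>\<in>Poly_Mapping.keys p. Poly_Mapping.keys \<alpha> \<subseteq> {1..m}}"

definition poly_ring :: "nat \<Rightarrow> 'k::field mpoly ring" where
  "poly_ring m = \<lparr>carrier = polys m, mult = (*), one = 1, zero = 0, add = (+)\<rparr>"

text \<open>
  The \<open>'k\<close>-algebra homomorphism that sends each \<open>x\<^sub>i\<close> to \<open>\<sigma> i\<close>
  (see \<open>subst_ring_hom\<close>, \<open>subst_const\<close> and \<open>subst_xvar\<close> below).
\<close>

definition subst :: "(nat \<Rightarrow> 'k::field mpoly) \<Rightarrow> 'k mpoly \<Rightarrow> 'k mpoly" where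
  "subst \<sigma> p = (\<Sum>\<alpha>\<in>Poly_Mapping.keys p. const (Poly_Mapping.lookup p \<alpha>) *
                 (\<Prod>i\<in>Poly_Mapping.keys \<alpha>. \<sigma> i ^ Poly_Mapping.lookup \<alpha> i))"

definition Inc :: "nat \<Rightarrow> nat \<Rightarrow> (nat \<Rightarrow> nat) set" where
  "Inc n m = {\<pi> \<in> {1..n} \<rightarrow>\<^sub>E {1..m}. strict_mono_on {1..n} \<pi>}"

definition induced_hom :: "(nat \<Rightarrow> nat) \<Rightarrow> 'k::field mpoly \<Rightarrow> 'k mpoly" where
  "induced_hom \<pi> = subst (\<lambda>i. xvar (\<pi> i))"

definition Inc_ideal :: "nat \<Rightarrow> nat \<Rightarrow> 'k::field mpoly set \<Rightarrow> 'k mpoly set" where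
  "Inc_ideal n m I = genideal (poly_ring m) (\<Union>\<pi>\<in>Inc n m. induced_hom \<pi> ` I)"

text \<open>A simple graph on the vertex set \<open>{1..m}\<close> is given by its set of edges.\<close>

definition simple_graph :: "nat \<Rightarrow> nat set set \<Rightarrow> bool" where
  "simple_graph m E \<longleftrightarrow> (\<forall>e\<in>E. e \<subseteq> {1..m} \<and> card e = 2)"

definition complement_graph :: "nat \<Rightarrow> nat set set \<Rightarrow> nat set set" where
  "complement_graph m E = {e. e \<subseteq> {1..m} \<and> card e = 2 \<and> e \<notin> E}"

definition line_graph :: "nat \<Rightarrow> nat set set" where
  "line_graph m = {{i, i + 1} | i. 1 \<le> i \<and> i + 1 \<le> m}"

definition edge_ideal :: "nat \<Rightarrow> nat set set \<Rightarrow> 'k::field mpoly set" where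
  "edge_ideal m E = genideal (poly_ring m) {xvar i * xvar j | i j. {i, j} \<in> E}"

definition associated_graph :: "nat \<Rightarrow> 'k::field mpoly set \<Rightarrow> nat set set \<Rightarrow> bool" where
  "associated_graph m I E \<longleftrightarrow> simple_graph m E \<and> edge_ideal m E = I"

lemma poly_ring_simps [simp]:
  "carrier (poly_ring m) = polys m"
  "mult (poly_ring m) = (*)" "one (poly_ring m) = 1"
  "zero (poly_ring m) = 0" "add (poly_ring m) = (+)"
  by (simp_all add: poly_ring_def)

lemma polys_0 [simp]: "0 \<in> polys m"
  and polys_1 [simp]: "1 \<in> polys m"
  and polys_const [simp]: "const c \<in> polys m"
  by (auto simp: polys_def const_def)

lemma polys_xvar [simp]: "i \<in> {1..m} \<Longrightarrow> xvar i \<in> polys m"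
  by (auto simp: polys_def xvar_def)

lemma polys_add: "p \<in> polys m \<Longrightarrow> q \<in> polys m \<Longrightarrow> p + q \<in> polys m"
  using keys_add[of p q] by (fastforce simp: polys_def)

lemma polys_uminus: "p \<in> polys m \<Longrightarrow> - p \<in> polys m"
  by (simp add: polys_def)

lemma polys_mult: 
  assumes "p \<in> polys m" "q \<in> polys m" shows "p * q \<in> polys m"
  unfolding polys_def
proof safe
  fix \<alpha> i
  assume "\<alpha> \<in> Poly_Mapping.keys (p * q)" and i: "i \<in> Poly_Mapping.keys \<alpha>"
  then obtain \<beta> \<gamma> where "\<alpha> = \<beta> + \<gamma>" "\<beta> \<in> Poly_Mapping.keys p" "\<gamma> \<in> Poly_Mapping.keys q"
    using keys_mult[of p q] by blast
  with assms i show "i \<in> {1..m}"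
    using keys_add[of \<beta> \<gamma>] by (fastforce simp: polys_def)
qed

lemma cring_poly_ring: "cring (poly_ring m :: 'k::field mpoly ring)"
proof (rule cringI)
  show "abelian_group (poly_ring m :: 'k mpoly ring)"
  proof (rule abelian_groupI)
    fix p :: "'k mpoly" assume "p \<in> carrier (poly_ring m)"
    then show "\<exists>q\<in>carrier (poly_ring m). q \<oplus>\<^bsub>poly_ring m\<^esub> p = \<zero>\<^bsub>poly_ring m\<^esub>"
      by (auto intro!: bexI[of _ "- p"] polys_uminus)
  qed (auto simp: polys_add add_ac)
  show "comm_monoid (poly_ring m :: 'k mpoly ring)"
    by (rule comm_monoidI) (auto simp: polys_mult mult_ac)
qed (auto simp: algebra_simps)

lemma subst_superset:
  assumes "finite A" "Poly_Mapping.keys p \<subseteq> A"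
  shows "subst \<sigma> p = (\<Sum>\<alpha>\<in>A. const (Poly_Mapping.lookup p \<alpha>) *
                 (\<Prod>i\<in>Poly_Mapping.keys \<alpha>. \<sigma> i ^ Poly_Mapping.lookup \<alpha> i))"
  unfolding subst_def
  by (rule sum.mono_neutral_left) (use assms in \<open>auto simp: const_def in_keys_iff\<close>)

lemma subst_single:
  "subst \<sigma> (Poly_Mapping.single \<alpha> c) =
     const c * (\<Prod>i\<in>Poly_Mapping.keys \<alpha>. \<sigma> i ^ Poly_Mapping.lookup \<alpha> i)"
  by (subst subst_superset[of "{\<alpha>}"]) auto

lemma subst_0 [simp]: "subst \<sigma> 0 = 0"
  by (simp add: subst_def)

lemma subst_const [simp]: "subst \<sigma> (const c) = const c"
  unfolding const_def by (simp add: subst_single) (simp add: const_def)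

lemma subst_xvar [simp]: "subst \<sigma> (xvar i) = \<sigma> i"
  unfolding xvar_def by (simp add: subst_single) (simp add: const_def)

lemma subst_add: "subst \<sigma> (p + q) = subst \<sigma> p + subst \<sigma> q"
proof -
  let ?A = "Poly_Mapping.keys p \<union> Poly_Mapping.keys q"
  have "Poly_Mapping.keys (p + q) \<subseteq> ?A" by (rule keys_add)
  then show ?thesis
    by (simp add: subst_superset[of ?A] lookup_add const_def single_add distrib_right sum.distrib)
qed

lemma prod_pow_add:
  fixes \<sigma> :: "nat \<Rightarrow> 'k::field mpoly"
  shows "(\<Prod>i\<in>Poly_Mapping.keys (\<alpha> + \<beta>). \<sigma> i ^ Poly_Mapping.lookup (\<alpha> + \<beta>) i) =
    (\<Prod>i\<in>Poly_Mapping.keys \<alpha>. \<sigma> i ^ Poly_Mapping.lookup \<alpha> i) *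
    (\<Prod>i\<in>Poly_Mapping.keys \<beta>. \<sigma> i ^ Poly_Mapping.lookup \<beta> i)"
proof -
  let ?A = "Poly_Mapping.keys \<alpha> \<union> Poly_Mapping.keys \<beta>"
  have ext: "(\<Prod>i\<in>Poly_Mapping.keys \<gamma>. \<sigma> i ^ Poly_Mapping.lookup \<gamma> i) =
      (\<Prod>i\<in>?A. \<sigma> i ^ Poly_Mapping.lookup \<gamma> i)" if "Poly_Mapping.keys \<gamma> \<subseteq> ?A" for \<gamma>
    by (rule prod.mono_neutral_left) (use that in \<open>auto simp: in_keys_iff\<close>)
  have "(\<Prod>i\<in>Poly_Mapping.keys (\<alpha> + \<beta>). \<sigma> i ^ Poly_Mapping.lookup (\<alpha> + \<beta>) i) =
      (\<Prod>i\<in>?A. \<sigma> i ^ Poly_Mapping.lookup (\<alpha> + \<beta>) i)"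
    by (intro ext keys_add)
  then show ?thesis
    by (simp add: ext[of \<alpha>] ext[of \<beta>] lookup_add power_add prod.distrib)
qed

lemma mpoly_induct:
  fixes p :: "'k::field mpoly"
  assumes "P 0" "\<And>\<alpha> c q. P q \<Longrightarrow> P (Poly_Mapping.single \<alpha> c + q)"
  shows "P p"
proof -
  have "P (\<Sum>\<alpha>\<in>A. Poly_Mapping.single \<alpha> (Poly_Mapping.lookup p \<alpha>))" if "finite A" for A
    using that by induction (auto intro: assms)
  moreover have "p = (\<Sum>\<alpha>\<in>Poly_Mapping.keys p. Poly_Mapping.single \<alpha> (Poly_Mapping.lookup p \<alpha>))"
    by (rule poly_mapping_eqI)
       (auto simp: lookup_sum lookup_single when_def in_keys_iff sum.delta)
  ultimately show ?thesis by (metis finite_keys)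
qed

lemma subst_mult: "subst \<sigma> (p * q) = subst \<sigma> p * subst \<sigma> q"
proof (induction p rule: mpoly_induct)
  case (2 \<alpha> c p)
  have "subst \<sigma> (Poly_Mapping.single \<alpha> c * q) = subst \<sigma> (Poly_Mapping.single \<alpha> c) * subst \<sigma> q"
  proof (induction q rule: mpoly_induct)
    case (2 \<beta> d q)
    have "const (c * d) = const c * const d"
      by (simp add: const_def mult_single)
    then have "subst \<sigma> (Poly_Mapping.single \<alpha> c * Poly_Mapping.single \<beta> d) =
        subst \<sigma> (Poly_Mapping.single \<alpha> c) * subst \<sigma> (Poly_Mapping.single \<beta> d)"
      by (simp add: mult_single subst_single prod_pow_add mult_ac)
    then show ?case
      by (simp add: distrib_left subst_add 2)
  qed simp
  then show ?case by (simp add: distrib_right subst_add 2)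
qed simp

lemma subst_closed:
  assumes "p \<in> polys n" "\<And>i. i \<in> {1..n} \<Longrightarrow> \<sigma> i \<in> polys m"
  shows "subst \<sigma> p \<in> polys m"
proof -
  have sum: "sum f A \<in> polys m" if "\<And>a. a \<in> A \<Longrightarrow> f a \<in> polys m" for f and A :: "'b set"
    using that by (induction A rule: infinite_finite_induct) (auto intro: polys_add)
  have prod: "prod f A \<in> polys m" if "\<And>a. a \<in> A \<Longrightarrow> f a \<in> polys m" for f and A :: "'b set"
    using that by (induction A rule: infinite_finite_induct) (auto intro: polys_mult)
  have power: "q ^ e \<in> polys m" if "q \<in> polys m" for q :: "'a mpoly" and e
    using that by (induction e) (auto intro: polys_mult)
  have \<sigma>: "\<sigma> i \<in> polys m" if "\<alpha> \<in> Poly_Mapping.keys p" "i \<in> Poly_Mapping.keys \<alpha>" for \<alpha> i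
    using assms that by (force simp: polys_def[of n])
  show ?thesis unfolding subst_def
    by (intro sum polys_mult prod power polys_const \<sigma>)
qed

lemma subst_ring_hom:
  assumes "\<And>i. i \<in> {1..n} \<Longrightarrow> \<sigma> i \<in> polys m"
  shows "subst \<sigma> \<in> ring_hom (poly_ring n) (poly_ring m)"
proof (rule ring_hom_memI)
  have "subst \<sigma> (const 1) = const 1" by (rule subst_const)
  then show "subst \<sigma> \<one>\<^bsub>poly_ring n\<^esub> = \<one>\<^bsub>poly_ring m\<^esub>" by (simp add: const_def)
qed (use assms in \<open>auto simp: subst_add subst_mult intro: subst_closed\<close>)

lemma line_graph_complement_iff:
  assumes "i < j"
  shows "{i, j} \<in> complement_graph m (line_graph m) \<longleftrightarrow> 1 \<le> i \<and> j \<le> m \<and> j > i + 1"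
  using assms by (auto simp: complement_graph_def line_graph_def doubleton_eq_iff)

end

theory Submission
  imports Defs "HOL-Algebra.QuotRing"
begin

text \<open>
  Both inclusions between \<open>Inc_ideal n m I\<close>, where \<open>3 \<le> n \<le> m\<close> and \<open>I\<close> is the edge
  ideal of the complement of the line graph on \<open>{1..n}\<close>, and the edge ideal of the complement of the line graph
  on \<open>{1..m}\<close> are statements about generators. A strictly increasing map does not shrink gaps, so
  it sends a generator \<open>x\<^sub>i x\<^sub>j\<close> with \<open>j - i \<ge> 2\<close> to another one
  (\<open>Inc_ideal_gap_two_subset\<close>). Conversely every pair \<open>a < b\<close> in \<open>{1..m}\<close> with \<open>b - a \<ge> 2\<close> is the
  image of such a pair in \<open>{1..n}\<close> (\<open>Inc_hits_gap_two\<close>): one squeezes the three gaps that \<open>a\<close> and \<open>b\<close>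
  cut out of \<open>{1..m}\<close> until they fit into \<open>{1..n}\<close>, and \<open>n \<ge> 3\<close> leaves room for an
  element strictly between the two.

  The graph is determined by its edge ideal (\<open>edge_ideal_inject\<close>), because
  \<open>x\<^sub>i x\<^sub>j\<close> lies in the edge ideal only if \<open>{i, j}\<close> is an edge: the ideal of a graph in which \<open>{i, j}\<close>
  is missing vanishes at the point with \<open>x\<^sub>i = x\<^sub>j = 1\<close> and all other coordinates \<open>0\<close>, where
  \<open>x\<^sub>i x\<^sub>j\<close> does not.
\<close>

definition gap_two_gens :: "nat \<Rightarrow> 'k::field mpoly set" where
  "gap_two_gens m = {xvar a * xvar b | a b. 1 \<le> a \<and> a < b \<and> b \<le> m \<and> b - a \<ge> 2}"

lemma (in ring_hom_ring) image_genideal_subset: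
  assumes "A \<subseteq> carrier R" "ideal K S" "h ` A \<subseteq> K"
  shows "h ` genideal R A \<subseteq> K"
proof -
  have "genideal R A \<subseteq> {r \<in> carrier R. h r \<in> K}"
    using assms by (intro R.genideal_minimal ideal_vimage) auto
  then show ?thesis by auto
qed

lemma subst_ring_hom_ring:
  fixes \<sigma> :: "nat \<Rightarrow> 'k::field mpoly"
  assumes "\<And>i. i \<in> {1..n} \<Longrightarrow> \<sigma> i \<in> polys m"
  shows "ring_hom_ring (poly_ring n) (poly_ring m) (subst \<sigma>)"
  by (rule ring_hom_ringI2[OF cring.axioms(1)[OF cring_poly_ring] cring.axioms(1)[OF cring_poly_ring]
    subst_ring_hom[OF assms]])

lemma gap_two_gens_polys: "gap_two_gens m \<subseteq> polys m"
  by (auto simp: gap_two_gens_def intro!: polys_mult)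

lemma edge_ideal_complement_line_graph:
  "edge_ideal m (complement_graph m (line_graph m)) = genideal (poly_ring m) (gap_two_gens m)"
proof -
  let ?C = "complement_graph m (line_graph m)"
  have "\<exists>a b. xvar i * xvar j = xvar a * (xvar b :: 'a mpoly) \<and> 1 \<le> a \<and> a < b \<and> b \<le> m \<and> b - a \<ge> 2"
    if "{i, j} \<in> ?C" for i j
  proof (cases i j rule: linorder_cases)
    case less
    with that have "1 \<le> i \<and> i < j \<and> j \<le> m \<and> j - i \<ge> 2"
      by (auto simp: line_graph_complement_iff)
    then show ?thesis by blast
  next
    case equal
    with that show ?thesis by (simp add: complement_graph_def)
  next
    case greater
    with that have "1 \<le> j \<and> j < i \<and> i \<le> m \<and> i - j \<ge> 2"
      by (auto simp: line_graph_complement_iff insert_commute[of i])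
    then show ?thesis by (intro exI[of _ j] exI[of _ i]) (simp add: mult.commute)
  qed
  moreover have "{a, b} \<in> ?C" if "1 \<le> a" "a < b" "b \<le> m" "b - a \<ge> 2" for a b
    using that by (simp add: line_graph_complement_iff)
  ultimately have "{xvar i * xvar j | i j. {i, j} \<in> ?C} = (gap_two_gens m :: 'a mpoly set)"
    unfolding gap_two_gens_def by blast
  then show ?thesis by (simp add: edge_ideal_def)
qed

lemma Inc_gap_le:
  assumes "\<pi> \<in> Inc n m" "1 \<le> i" "i \<le> j" "j \<le> n"
  shows "\<pi> i + (j - i) \<le> \<pi> j"
  using assms(3,4)
proof (induction j rule: dec_induct)
  case (step k)
  have "\<pi> k < \<pi> (Suc k)"
    using assms(1,2) step by (auto simp: Inc_def intro: strict_mono_onD)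
  with step show ?case by simp
qed simp

text \<open>
  Put \<open>a\<close> and \<open>b\<close> at the positions \<open>i\<close> and \<open>j\<close> and translate each of the three remaining blocks of \<open>{1..n}\<close>.
  The result is strictly increasing into \<open>{1..m}\<close> as soon as no block is longer than the gap that
  receives it: \<open>i \<le> a\<close>, \<open>j - i \<le> b - a\<close> and \<open>n - j \<le> m - b\<close>.
\<close>

lemma Inc_hits_gap_two:
  assumes "3 \<le> n" "n \<le> m" "1 \<le> a" "a + 2 \<le> b" "b \<le> m"
  obtains \<pi> i j where "\<pi> \<in> Inc n m" "1 \<le> i" "i + 2 \<le> j" "j \<le> n" "\<pi> i = a" "\<pi> j = b"
proof -
  \<comment> \<open>The largest \<open>i \<le> a\<close> that leaves room for \<open>i + 2 \<le> j \<le> n\<close>, then the smallest \<open>j \<ge> i + 2\<close>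
    with \<open>n - j \<le> m - b\<close>; \<open>j - i \<le> b - a\<close> follows from \<open>a + 2 \<le> b\<close>, \<open>b \<le> m\<close> and \<open>n \<le> m\<close>.\<close>
  define i where "i = min a (n - 2)"
  define j where "j = max (i + 2) (b - (m - n))"
  have ij: "1 \<le> i" "i + 2 \<le> j" "j \<le> n" "i \<le> a" "j + a \<le> b + i" "n + b \<le> m + j"
    using assms by (auto simp: i_def j_def)
  define \<pi> where
    "\<pi> = restrict (\<lambda>k. if k < i then k else if k < j then k - i + a else k - j + b) {1..n}"
  have "\<pi> \<in> {1..n} \<rightarrow>\<^sub>E {1..m}" "strict_mono_on {1..n} \<pi>"
    using ij assms by (auto simp: \<pi>_def intro!: strict_mono_onI)
  then have "\<pi> \<in> Inc n m" by (simp add: Inc_def)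
  moreover have "\<pi> i = a" "\<pi> j = b"
    using ij by (auto simp: \<pi>_def)
  ultimately show ?thesis using that ij by blast
qed

lemma induced_hom_xvar_mult:
  "induced_hom \<pi> (xvar i * xvar j) = xvar (\<pi> i) * xvar (\<pi> j)"
  by (simp add: induced_hom_def subst_mult)

lemma Inc_mem_range: "\<pi> \<in> Inc n m \<Longrightarrow> i \<in> {1..n} \<Longrightarrow> \<pi> i \<in> {1..m}"
  by (auto simp: Inc_def dest: PiE_mem)

lemma induced_hom_ring_hom_ring:
  "\<pi> \<in> Inc n m \<Longrightarrow>
    ring_hom_ring (poly_ring n) (poly_ring m) (induced_hom \<pi> :: 'k::field mpoly \<Rightarrow> 'k mpoly)"
  unfolding induced_hom_def by (rule subst_ring_hom_ring) (rule polys_xvar[OF Inc_mem_range])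

lemma Inc_ideal_gap_two_subset:
  "Inc_ideal n m (genideal (poly_ring n) (gap_two_gens n))
    \<subseteq> genideal (poly_ring m) (gap_two_gens m :: 'k::field mpoly set)"
proof -
  interpret Rm: cring "poly_ring m :: 'k mpoly ring" by (rule cring_poly_ring)
  let ?K = "genideal (poly_ring m) (gap_two_gens m :: 'k mpoly set)"
  have K: "ideal ?K (poly_ring m)"
    by (intro Rm.genideal_ideal) (simp add: gap_two_gens_polys)
  have gens: "gap_two_gens m \<subseteq> ?K"
    by (intro Rm.genideal_self) (simp add: gap_two_gens_polys)
  have "induced_hom \<pi> ` genideal (poly_ring n) (gap_two_gens n) \<subseteq> ?K" if \<pi>: "\<pi> \<in> Inc n m" for \<pi>
  proof (rule ring_hom_ring.image_genideal_subset[OF induced_hom_ring_hom_ring[OF \<pi>] _ K])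
    show "induced_hom \<pi> ` gap_two_gens n \<subseteq> ?K"
    proof
      fix p :: "'k mpoly" assume "p \<in> induced_hom \<pi> ` gap_two_gens n"
      then obtain i j where ij: "1 \<le> i" "i < j" "j \<le> n" "j - i \<ge> 2"
        and p: "p = xvar (\<pi> i) * xvar (\<pi> j)"
        by (auto simp: gap_two_gens_def induced_hom_xvar_mult)
      have "\<pi> i + (j - i) \<le> \<pi> j" "\<pi> i \<in> {1..m}" "\<pi> j \<in> {1..m}"
        using ij Inc_gap_le[OF \<pi>, of i j] Inc_mem_range[OF \<pi>] by auto
      with ij have "1 \<le> \<pi> i \<and> \<pi> i < \<pi> j \<and> \<pi> j \<le> m \<and> \<pi> j - \<pi> i \<ge> 2" by auto
      then have "p \<in> gap_two_gens m" unfolding p gap_two_gens_def by blast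
      then show "p \<in> ?K" using gens by blast
    qed
  qed (simp add: gap_two_gens_polys)
  then show ?thesis
    unfolding Inc_ideal_def by (intro Rm.genideal_minimal K) blast
qed

lemma gap_two_subset_Inc_ideal:
  assumes "3 \<le> n" "n \<le> m"
  shows "genideal (poly_ring m) (gap_two_gens m :: 'k::field mpoly set)
    \<subseteq> Inc_ideal n m (genideal (poly_ring n) (gap_two_gens n))"
proof -
  interpret Rn: cring "poly_ring n :: 'k mpoly ring" by (rule cring_poly_ring)
  interpret Rm: cring "poly_ring m :: 'k mpoly ring" by (rule cring_poly_ring)
  let ?I = "genideal (poly_ring n) (gap_two_gens n :: 'k mpoly set)"
  have gens: "gap_two_gens n \<subseteq> ?I"
    by (intro Rn.genideal_self) (simp add: gap_two_gens_polys)
  have I: "ideal ?I (poly_ring n)"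
    by (intro Rn.genideal_ideal) (simp add: gap_two_gens_polys)
  have U: "(\<Union>\<pi>\<in>Inc n m. induced_hom \<pi> ` ?I) \<subseteq> carrier (poly_ring m)"
    by (intro UN_least image_subsetI)
      (rule ring_hom_closed[OF ring_hom_ring.homh[OF induced_hom_ring_hom_ring] ideal.Icarr[OF I]])
  have "gap_two_gens m \<subseteq> Inc_ideal n m ?I"
  proof
    fix p :: "'k mpoly" assume "p \<in> gap_two_gens m"
    then obtain a b where "1 \<le> a" "a < b" "b \<le> m" "b - a \<ge> 2" and p: "p = xvar a * xvar b"
      unfolding gap_two_gens_def by blast
    then have ab: "1 \<le> a" "a + 2 \<le> b" "b \<le> m" by auto
    obtain \<pi> i j where \<pi>: "\<pi> \<in> Inc n m" and ij: "1 \<le> i" "i + 2 \<le> j" "j \<le> n"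
      and eq: "\<pi> i = a" "\<pi> j = b"
      using Inc_hits_gap_two[OF assms ab] .
    have "1 \<le> i \<and> i < j \<and> j \<le> n \<and> j - i \<ge> 2" using ij by auto
    then have "xvar i * xvar j \<in> ?I"
      using gens unfolding gap_two_gens_def by blast
    moreover have "p = induced_hom \<pi> (xvar i * xvar j)"
      by (simp add: p eq induced_hom_xvar_mult)
    ultimately show "p \<in> Inc_ideal n m ?I"
      using \<pi> Rm.genideal_self[OF U] unfolding Inc_ideal_def by blast
  qed
  moreover have "ideal (Inc_ideal n m ?I) (poly_ring m)"
    unfolding Inc_ideal_def by (rule Rm.genideal_ideal[OF U])
  ultimately show ?thesis by (intro Rm.genideal_minimal)
qed

lemma edge_gens_polys:
  assumes "simple_graph m E"
  shows "{xvar i * xvar j | i j. {i, j} \<in> E} \<subseteq> (polys m :: 'k::field mpoly set)"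
proof -
  have "i \<in> {1..m}" "j \<in> {1..m}" if "{i, j} \<in> E" for i j
    using assms that unfolding simple_graph_def by blast+
  then show ?thesis by (auto intro!: polys_mult polys_xvar)
qed

text \<open>
  The evaluation that sends \<open>x\<^sub>i, x\<^sub>j\<close> to \<open>1\<close> and every other variable to \<open>0\<close> kills the generator
  \<open>x\<^sub>a x\<^sub>b\<close> of every edge \<open>{a, b} \<noteq> {i, j}\<close>, since the two ends of an edge are distinct and so
  cannot both lie in \<open>{i, j}\<close>. It does not kill \<open>x\<^sub>i x\<^sub>j\<close>.
\<close>

lemma xvar_mult_in_edge_ideal_iff:
  assumes E: "simple_graph m E"
  shows "xvar i * xvar j \<in> (edge_ideal m E :: 'k::field mpoly set) \<longleftrightarrow> {i, j} \<in> E"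
proof
  interpret Rm: cring "poly_ring m :: 'k mpoly ring" by (rule cring_poly_ring)
  let ?A = "{xvar i * xvar j | i j. {i, j} \<in> E} :: 'k mpoly set"
  show "xvar i * xvar j \<in> (edge_ideal m E :: 'k mpoly set)" if "{i, j} \<in> E"
    using that Rm.genideal_self[of ?A] edge_gens_polys[OF E]
    unfolding edge_ideal_def by auto
  define \<sigma> :: "nat \<Rightarrow> 'k mpoly" where "\<sigma> k = (if k \<in> {i, j} then 1 else 0)" for k
  interpret h: ring_hom_ring "poly_ring m" "poly_ring m" "subst \<sigma>"
    by (rule subst_ring_hom_ring) (simp add: \<sigma>_def)
  show "{i, j} \<in> E" if mem: "xvar i * xvar j \<in> (edge_ideal m E :: 'k mpoly set)"
  proof (rule ccontr)
    assume nE: "{i, j} \<notin> E"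
    have "\<sigma> a * \<sigma> b = 0" if ab: "{a, b} \<in> E" for a b
    proof (rule ccontr)
      assume "\<sigma> a * \<sigma> b \<noteq> 0"
      then have "{a, b} \<subseteq> {i, j}" by (auto simp: \<sigma>_def split: if_splits)
      moreover have "card {a, b} = 2" using E ab by (auto simp: simple_graph_def)
      ultimately have "{a, b} = {i, j}" by (auto simp: card_insert_if split: if_splits)
      with ab nE show False by simp
    qed
    then have "subst \<sigma> ` ?A \<subseteq> {0}"
      by (auto simp: subst_mult)
    then have "subst \<sigma> ` edge_ideal m E \<subseteq> {0}"
      unfolding edge_ideal_def using edge_gens_polys[OF E] Rm.zeroideal
      by (intro h.image_genideal_subset) auto
    with mem have "subst \<sigma> (xvar i * xvar j) = 0" by blast
    then show False by (simp add: subst_mult \<sigma>_def)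
  qed
qed

lemma edge_ideal_inject:
  assumes E: "simple_graph m E" and F: "simple_graph m F"
    and eq: "(edge_ideal m E :: 'k::field mpoly set) = edge_ideal m F"
  shows "E = F"
proof -
  have "{i, j} \<in> E \<longleftrightarrow> {i, j} \<in> F" for i j
    using xvar_mult_in_edge_ideal_iff[OF E, where 'k='k] xvar_mult_in_edge_ideal_iff[OF F, where 'k='k] eq
    by blast
  moreover have "\<exists>i j. e = {i, j}" if "e \<in> E \<union> F" for e
    using that E F unfolding simple_graph_def by (metis Un_iff card_2_iff)
  ultimately show ?thesis by (metis Un_iff subsetI subset_antisym)
qed

theorem lemma3p8:
  fixes n r :: nat and I J :: "'k::field mpoly set"
  assumes "n \<ge> 3"
    and "I = edge_ideal n (complement_graph n (line_graph n))"
    and "J = Inc_ideal n (n + r) I"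
  shows "J = genideal (poly_ring (n + r))
               {xvar a * xvar b | a b. 1 \<le> a \<and> a < b \<and> b \<le> n + r \<and> b - a \<ge> 2}
    \<and> J = edge_ideal (n + r) (complement_graph (n + r) (line_graph (n + r)))
    \<and> (\<forall>E. associated_graph (n + r) J E \<longleftrightarrow>
            E = complement_graph (n + r) (line_graph (n + r)))"
proof -
  let ?C = "complement_graph (n + r) (line_graph (n + r))"
  have J: "J = genideal (poly_ring (n + r)) (gap_two_gens (n + r))"
    unfolding assms(2,3) edge_ideal_complement_line_graph
    using assms(1) by (intro subset_antisym Inc_ideal_gap_two_subset gap_two_subset_Inc_ideal) auto
  then have JC: "J = edge_ideal (n + r) ?C"
    by (simp add: edge_ideal_complement_line_graph)
  have "simple_graph (n + r) ?C"
    by (simp add: simple_graph_def complement_graph_def)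
  then have "\<forall>E. associated_graph (n + r) J E \<longleftrightarrow> E = ?C"
    unfolding associated_graph_def JC using edge_ideal_inject by blast
  with J JC show ?thesis by (simp add: gap_two_gens_def)
qed

end
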